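(* Let $m,n\ge 1$ be integers. The number of weakly decreasing recurrent configurations $(a_1,\ldots,a_{m-1},-;b_1,\ldots,b_n)$ of the Abelian sandpile model on the complete split graph $S_{m,n}$ with sink the clique vertex $v_m$ is equal to $$\frac{1}{m}\binom{2m-2}{m-1}\binom{2m-2+n}{n}.$$
   Context: The complete split graph $S_{m,n}$ has clique vertices $v_1,\ldots,v_m$ and independent vertices $w_1,\ldots,w_n$. Every two distinct clique vertices are joined by one edge, every clique vertex is joined to every independent vertex by one edge, and no two independent vertices are adjacent. Abelian sandpile model on a graph $G$ with sink $s$: a configuration assigns a non-negative integer (number of grains) to each non-sink vertex. A non-sink vertex $v$ is stable if its number of grains is strictly less than $\deg(v)$, and unstable otherwise. A configuration is stable if all non-sink vertices are stable. An unstable vertex may topple, i.e. it loses $\deg(v)$ grains and gives one grain to each neighbour; grains given to the sink disappear. Toppling unstable vertices eventually leads to a unique stable configuration, the stabilisation. A stable configuration $c$ is recurrent if it can be reached, by adding grains and toppling, from every configuration: for every configuration $d$ there is a configuration $e$ such that the stabilisation of $d+e$ is $c$. With sink $v_m$, a configuration is written $(a_1,\ldots,a_{m-1},-;b_1,\ldots,b_n)$ where $a_i$ is the number of grains at $v_i$ and $b_j$ the number of grains at $w_j$. It is weakly decreasing if $a_1\ge\cdots\ge a_{m-1}$ and $b_1\ge\cdots\ge b_n$. *)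

theory Defs
  imports Complex_Main
begin

text \<open>A finite simple graph is given by its vertex set \<open>V\<close> and its set \<open>E\<close> of edges, each edge
  being a two-element subset of \<open>V\<close>.\<close>

definition degree :: "'v set set \<Rightarrow> 'v \<Rightarrow> nat" where
  "degree E v = card {e \<in> E. v \<in> e}"

text \<open>Configurations live on the non-sink vertices. They are encoded as total functions that
  vanish elsewhere, so that distinct functions represent distinct configurations and sets of
  configurations can be counted.\<close>

definition configs :: "'v set \<Rightarrow> 'v \<Rightarrow> ('v \<Rightarrow> nat) set" where
  "configs V s = {c. \<forall>v. v \<notin> V - {s} \<longrightarrow> c v = 0}"

definition stable :: "'v set \<Rightarrow> 'v set set \<Rightarrow> 'v \<Rightarrow> ('v \<Rightarrow> nat) \<Rightarrow> bool" where
  "stable V E s c \<longleftrightarrow> (\<forall>v \<in> V - {s}. c v < degree E v)"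

definition topple :: "'v set set \<Rightarrow> 'v \<Rightarrow> 'v \<Rightarrow> ('v \<Rightarrow> nat) \<Rightarrow> ('v \<Rightarrow> nat)" where
  "topple E s v c =
     (\<lambda>u. if u = v then c u - degree E v
          else if {u, v} \<in> E \<and> u \<noteq> s then c u + 1
          else c u)"

definition topple_step ::
    "'v set \<Rightarrow> 'v set set \<Rightarrow> 'v \<Rightarrow> ('v \<Rightarrow> nat) \<Rightarrow> ('v \<Rightarrow> nat) \<Rightarrow> bool" where
  "topple_step V E s c c' \<longleftrightarrow>
     (\<exists>v \<in> V - {s}. degree E v \<le> c v \<and> c' = topple E s v c)"

text \<open>\<open>stabilisation V E s c c'\<close>: the stabilisation of \<open>c\<close> is \<open>c'\<close>. By \<open>stabilisation_unique\<close>
  below there is at most one such \<open>c'\<close>.\<close>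

definition stabilisation ::
    "'v set \<Rightarrow> 'v set set \<Rightarrow> 'v \<Rightarrow> ('v \<Rightarrow> nat) \<Rightarrow> ('v \<Rightarrow> nat) \<Rightarrow> bool" where
  "stabilisation V E s c c' \<longleftrightarrow> (topple_step V E s)\<^sup>*\<^sup>* c c' \<and> stable V E s c'"

definition recurrent :: "'v set \<Rightarrow> 'v set set \<Rightarrow> 'v \<Rightarrow> ('v \<Rightarrow> nat) \<Rightarrow> bool" where
  "recurrent V E s c \<longleftrightarrow>
     c \<in> configs V s \<and> stable V E s c \<and>
     (\<forall>d \<in> configs V s. \<exists>e \<in> configs V s. stabilisation V E s (\<lambda>v. d v + e v) c)"

lemma topple_commute:
  assumes "u \<noteq> v" "degree E u \<le> c u" "degree E v \<le> c v"
  shows "topple E s u (topple E s v c) = topple E s v (topple E s u c)"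
  using assms by (auto simp: topple_def fun_eq_iff)

lemma topple_step_diamond:
  assumes "topple_step V E s c x" "topple_step V E s c y"
  shows "x = y \<or> (\<exists>z. topple_step V E s x z \<and> topple_step V E s y z)"
proof -
  obtain u v where u: "u \<in> V - {s}" "degree E u \<le> c u" "x = topple E s u c"
    and v: "v \<in> V - {s}" "degree E v \<le> c v" "y = topple E s v c"
    using assms unfolding topple_step_def by blast
  show ?thesis
  proof (cases "u = v")
    case False
    have "degree E v \<le> x v" "degree E u \<le> y u"
      using False u v by (auto simp: topple_def)
    hence "topple_step V E s x (topple E s v x)" "topple_step V E s y (topple E s u y)"
      using u(1) v(1) unfolding topple_step_def by blast+
    moreover have "topple E s v x = topple E s u y"
      using topple_commute[OF False u(2) v(2)] u(3) v(3) by simp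
    ultimately show ?thesis by metis
  qed (use u v in simp)
qed

lemma stable_no_step: "stable V E s c \<Longrightarrow> \<not> topple_step V E s c c'"
  unfolding stable_def topple_step_def by (meson leD)

lemma step_to_stable:
  assumes "(topple_step V E s)\<^sup>*\<^sup>* c z" "stable V E s z" "topple_step V E s c y"
  shows "(topple_step V E s)\<^sup>*\<^sup>* y z"
  using assms
proof (induction arbitrary: y rule: converse_rtranclp_induct)
  case base
  then show ?case using stable_no_step by metis
next
  case (step c x)
  from topple_step_diamond[OF step.hyps(1) step.prems(2)] show ?case
  proof (elim disjE exE conjE)
    assume "x = y" then show ?thesis using step.hyps(2) by simp
  next
    fix w assume "topple_step V E s x w" "topple_step V E s y w"
    then show ?thesis
      using step.IH[OF step.prems(1)] by (meson converse_rtranclp_into_rtranclp)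
  qed
qed

lemma stabilisation_unique:
  assumes "stabilisation V E s c x" "stabilisation V E s c y"
  shows "x = y"
proof -
  have x: "(topple_step V E s)\<^sup>*\<^sup>* c x" "stable V E s x"
    and y: "(topple_step V E s)\<^sup>*\<^sup>* c y" "stable V E s y"
    using assms unfolding stabilisation_def by auto
  from y(1) have "(topple_step V E s)\<^sup>*\<^sup>* y x"
    by (induction rule: rtranclp_induct) (use x step_to_stable in metis)+
  then show ?thesis
    using y(2) stable_no_step by (metis converse_rtranclpE)
qed

datatype split_vertex = Clique nat | Indep nat

definition split_verts :: "nat \<Rightarrow> nat \<Rightarrow> split_vertex set" where
  "split_verts m n = Clique ` {1..m} \<union> Indep ` {1..n}"

definition split_edges :: "nat \<Rightarrow> nat \<Rightarrow> split_vertex set set" where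
  "split_edges m n =
     {{Clique i, Clique j} | i j. i \<in> {1..m} \<and> j \<in> {1..m} \<and> i \<noteq> j} \<union>
     {{Clique i, Indep j} | i j. i \<in> {1..m} \<and> j \<in> {1..n}}"

text \<open>The sink is \<open>Clique m\<close>, so the clique part of a configuration is indexed by \<open>{1..m - 1}\<close>.\<close>

definition weakly_decreasing :: "nat \<Rightarrow> nat \<Rightarrow> (split_vertex \<Rightarrow> nat) \<Rightarrow> bool" where
  "weakly_decreasing m n c \<longleftrightarrow>
     antimono_on {1..m - 1} (\<lambda>i. c (Clique i)) \<and> antimono_on {1..n} (\<lambda>j. c (Indep j))"

end

theory Submission
  imports Defs
begin

text \<open>
  By Dhar's criterion a stable configuration \<open>c\<close> is recurrent iff no non-empty set \<open>F\<close> of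
  non-sink vertices is forbidden, that is, every such \<open>F\<close> contains a vertex that has at least as
  many grains as neighbours inside \<open>F\<close>. The sink of a complete split graph is adjacent to all
  other vertices, and this makes the criterion easy to prove from the definition of recurrence.
  If \<open>c\<close> is reached from a configuration in which every vertex is unstable, then every vertex
  topples, and the vertex of \<open>F\<close> whose last toppling comes first has afterwards received a grain
  from each of its neighbours in \<open>F\<close>. Conversely, if there is no forbidden set, then a toppling
  of the sink adds one grain everywhere and makes every vertex topple exactly once, which restores
  \<open>c\<close>. So \<open>c\<close> plus \<open>k\<close> grains at every vertex stabilises to \<open>c\<close> for all \<open>k\<close>, and
  for large \<open>k\<close> this configuration exceeds any given one
  (\<open>recurrent_iff_no_forbidden\<close>).

  In a complete split graph the number of neighbours inside \<open>F\<close> depends only on how many clique and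
  how many independent vertices \<open>F\<close> has. For a weakly decreasing configuration it is therefore
  enough to look at the sets that consist of the clique vertices from \<open>v\<^sub>i\<close> on and of the
  independent vertices with fewer than \<open>m - i\<close> grains. This leaves one inequality
  for each \<open>i\<close>: \<open>a\<^sub>i \<ge> (m - 1 - i) + #{j. b\<^sub>j < m - i}\<close>
  (\<open>no_forbidden_split_iff\<close>).

  Such pairs of sequences encode Motzkin words with \<open>m - 1\<close> letters \<open>U\<close>, \<open>m - 1\<close> letters
  \<open>D\<close> and \<open>n\<close> letters \<open>H\<close>: each \<open>b\<^sub>j\<close> is the number of letters \<open>U\<close> before
  one of the letters \<open>H\<close>, and each \<open>a\<^sub>i\<close> is the position, within the subword of letters
  \<open>U\<close> and \<open>H\<close>, of the letter after which one of the letters \<open>D\<close> is placed. The \<open>p\<close>-th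
  \<open>U\<close> stands at position \<open>p - 1 + #{j. b\<^sub>j < p}\<close>, so the inequality for
  \<open>p = m - i\<close> says that the \<open>p\<close>-th \<open>D\<close> comes after the \<open>p\<close>-th \<open>U\<close>. Removing the
  last letter of a word gives a recursion for the number of prefixes of Motzkin words with given
  letter counts, and a ballot number times a multinomial coefficient solves it
  (\<open>card_motzkin_pairs\<close>).
\<close>

section \<open>Dhar's criterion for graphs with a universal sink\<close>

definition deg_in :: "'v set set \<Rightarrow> 'v set \<Rightarrow> 'v \<Rightarrow> nat" where
  "deg_in E F v = card {u \<in> F. {u, v} \<in> E}"

definition no_forbidden :: "'v set \<Rightarrow> 'v set set \<Rightarrow> ('v \<Rightarrow> nat) \<Rightarrow> bool" where
  "no_forbidden W E c \<longleftrightarrow> (\<forall>F \<subseteq> W. F \<noteq> {} \<longrightarrow> (\<exists>v \<in> F. deg_in E F v \<le> c v))"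

locale universal_sink =
  fixes V :: "'v set" and E :: "'v set set" and s :: 'v
  assumes finite_V: "finite V"
    and sink_in: "s \<in> V"
    and edges: "e \<in> E \<Longrightarrow> \<exists>u v. e = {u, v} \<and> u \<in> V \<and> v \<in> V \<and> u \<noteq> v"
    and sink_adj: "v \<in> V - {s} \<Longrightarrow> {s, v} \<in> E"
begin

lemma no_loop: "{v, v} \<notin> E"
proof
  assume "{v, v} \<in> E"
  from edges[OF this] show False by (auto simp: doubleton_eq_iff)
qed

lemma edge_in_V: "{u, v} \<in> E \<Longrightarrow> u \<in> V \<and> v \<in> V"
  using edges[of "{u, v}"] by (auto simp: doubleton_eq_iff)

lemma degree_eq_deg_in: "degree E v = deg_in E V v"
proof -
  have "{e \<in> E. v \<in> e} = (\<lambda>u. {u, v}) ` {u \<in> V. {u, v} \<in> E}"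
  proof (intro equalityI subsetI)
    fix e assume e: "e \<in> {e \<in> E. v \<in> e}"
    then obtain a b where "e = {a, b}" "a \<in> V" "b \<in> V" using edges by blast
    with e show "e \<in> (\<lambda>u. {u, v}) ` {u \<in> V. {u, v} \<in> E}"
      by (auto simp: image_iff insert_commute)
  qed auto
  moreover have "inj_on (\<lambda>u. {u, v}) {u \<in> V. {u, v} \<in> E}"
    by (auto simp: inj_on_def doubleton_eq_iff)
  ultimately show ?thesis
    by (simp add: degree_def deg_in_def card_image)
qed

lemma deg_in_remove:
  assumes "finite F" "v \<in> F"
  shows "deg_in E F u = deg_in E (F - {v}) u + (if {u, v} \<in> E then 1 else 0)"
proof (cases "{u, v} \<in> E")
  case True
  then have "{w \<in> F. {w, u} \<in> E} = insert v {w \<in> F - {v}. {w, u} \<in> E}"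
    using assms by (auto simp: insert_commute)
  then show ?thesis using True assms by (simp add: deg_in_def)
next
  case False
  then have "{w \<in> F. {w, u} \<in> E} = {w \<in> F - {v}. {w, u} \<in> E}"
    by (auto simp: insert_commute)
  then show ?thesis using False by (simp add: deg_in_def)
qed

lemma degree_nonsink:
  assumes "v \<in> V - {s}"
  shows "degree E v = deg_in E (V - {s}) v + 1"
  using deg_in_remove[OF finite_V sink_in, of v] sink_adj[OF assms]
  by (simp add: degree_eq_deg_in insert_commute)

text \<open>\<open>T\<close> is the set of vertices that have toppled so far. A vertex outside \<open>T\<close> never loses
  grains and so stays unstable. When \<open>v\<close> topples, a set \<open>F\<close> containing \<open>v\<close> is not forbidden,
  because \<open>F - {v}\<close> was not forbidden and a neighbour of \<open>v\<close> gains precisely the grain that it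
  needs after its degree inside the set has grown by one.\<close>

lemma toppled_set_invariant:
  assumes "(topple_step V E s)\<^sup>*\<^sup>* x y" "\<And>v. v \<in> V - {s} \<Longrightarrow> degree E v \<le> x v"
  shows "\<exists>T \<subseteq> V - {s}. (\<forall>v \<in> V - {s} - T. degree E v \<le> y v) \<and> no_forbidden T E y"
  using assms(1)
proof (induction rule: rtranclp_induct)
  case base
  show ?case using assms(2) by (intro exI[of _ "{}"]) (auto simp: no_forbidden_def)
next
  case (step y z)
  then obtain T where T: "T \<subseteq> V - {s}" "\<forall>v \<in> V - {s} - T. degree E v \<le> y v"
    "no_forbidden T E y" by blast
  from step obtain v where v: "v \<in> V - {s}" "degree E v \<le> y v" "z = topple E s v y"
    by (auto simp: topple_step_def)
  have mono: "y u \<le> z u" if "u \<noteq> v" for u using that v by (simp add: topple_def)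
  have gain: "z u = y u + (if {u, v} \<in> E then 1 else 0)" if "u \<noteq> v" "u \<in> V - {s}" for u
    using that v by (simp add: topple_def)
  have "\<exists>w \<in> F. deg_in E F w \<le> z w" if F: "F \<subseteq> insert v T" "F \<noteq> {}" for F
  proof (cases "v \<in> F")
    case False
    then have "F \<subseteq> T" using F(1) by blast
    then obtain w where w: "w \<in> F" "deg_in E F w \<le> y w"
      using F(2) T(3) unfolding no_forbidden_def by blast
    then have "w \<noteq> v" using False by blast
    then show ?thesis using w mono[of w] order_trans by blast
  next
    case True
    have fin: "finite F" using F T(1) v(1) finite_V by (meson finite_Diff finite_subset insert_subset)
    show ?thesis
    proof (cases "F = {v}")
      case True
      then have "{u \<in> F. {u, v} \<in> E} = {}" using no_loop by auto
      then have "deg_in E F v = 0" by (simp only: deg_in_def card.empty)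
      then show ?thesis using \<open>v \<in> F\<close> by (intro bexI[of _ v]) simp_all
    next
      case False
      with True have ne: "F - {v} \<noteq> {}" by blast
      have "F - {v} \<subseteq> T" using F by blast
      then obtain w where w: "w \<in> F - {v}" "deg_in E (F - {v}) w \<le> y w"
        using ne T(3) unfolding no_forbidden_def by blast
      then have "w \<in> V - {s}" using F T(1) by blast
      then have "deg_in E F w \<le> z w"
        using deg_in_remove[OF fin True, of w] gain[of w] w by simp
      then show ?thesis using w by blast
    qed
  qed
  then have "no_forbidden (insert v T) E z" by (auto simp: no_forbidden_def)
  moreover have "\<forall>u \<in> V - {s} - insert v T. degree E u \<le> z u"
    using T(2) mono by (auto intro: order_trans)
  ultimately show ?case using T(1) v(1) by (intro exI[of _ "insert v T"]) auto
qed

text \<open>Recurrence is applied to a configuration in which every vertex is unstable, so that a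
  stable outcome forces every vertex to have toppled.\<close>

lemma recurrent_imp_no_forbidden:
  assumes "recurrent V E s c"
  shows "no_forbidden (V - {s}) E c"
proof -
  let ?d = "\<lambda>v. if v \<in> V - {s} then degree E v else 0"
  have "?d \<in> configs V s" by (simp add: configs_def)
  then obtain e where e: "stabilisation V E s (\<lambda>v. ?d v + e v) c"
    using bspec[of "configs V s" _ ?d] assms unfolding recurrent_def by metis
  then have "\<exists>T \<subseteq> V - {s}. (\<forall>v \<in> V - {s} - T. degree E v \<le> c v) \<and> no_forbidden T E c"
    unfolding stabilisation_def by (intro toppled_set_invariant) auto
  then obtain T where "T \<subseteq> V - {s}" "\<forall>v \<in> V - {s} - T. degree E v \<le> c v" "no_forbidden T E c"
    by blast
  moreover have "v \<in> T" if "v \<in> V - {s}" for v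
    using calculation(2) e that unfolding stabilisation_def stable_def by (meson DiffI leD)
  then have "T = V - {s}" using calculation(1) by blast
  ultimately show ?thesis by simp
qed

text \<open>This is the burning algorithm. \<open>F\<close> is the set of vertices that have still to topple once.
  Measured against \<open>c\<close>, a vertex lacks the grains that its neighbours in \<open>F\<close> will send, and has
  its own degree in excess as long as it belongs to \<open>F\<close>. Since \<open>F\<close> is not forbidden, one of its
  vertices is unstable. Stating the balance as an equation between sums avoids truncated
  subtraction.\<close>

lemma burning:
  assumes "no_forbidden (V - {s}) E c" "F \<subseteq> V - {s}"
    and "\<And>u. u \<in> F \<Longrightarrow> x u + deg_in E F u = c u + degree E u"
    and "\<And>u. u \<in> V - {s} - F \<Longrightarrow> x u + deg_in E F u = c u"
    and "\<And>u. u \<notin> V - {s} \<Longrightarrow> x u = c u"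
  shows "(topple_step V E s)\<^sup>*\<^sup>* x c"
  using assms(2-)
proof (induction "card F" arbitrary: F x)
  case 0
  then have "F = {}" using finite_V finite_subset by fastforce
  then have "x = c" using 0 by (auto simp: fun_eq_iff deg_in_def)
  then show ?case by simp
next
  case (Suc k)
  have fin: "finite F" using Suc.prems(1) finite_V finite_subset by blast
  from Suc have "F \<noteq> {}" by auto
  then obtain v where v: "v \<in> F" "deg_in E F v \<le> c v"
    using assms(1) Suc.prems(1) unfolding no_forbidden_def by blast
  have vV: "v \<in> V - {s}" using v Suc.prems(1) by blast
  have unstable: "degree E v \<le> x v" using Suc.prems(2)[OF v(1)] v(2) by linarith
  let ?x = "topple E s v x"
  note rem = deg_in_remove[OF fin v(1)]
  have "(topple_step V E s)\<^sup>*\<^sup>* ?x c"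
  proof (rule Suc.hyps(1)[of "F - {v}"])
    show "k = card (F - {v})" using Suc.hyps(2) v fin by simp
    show "F - {v} \<subseteq> V - {s}" using Suc.prems(1) by blast
    show "?x u + deg_in E (F - {v}) u = c u + degree E u" if "u \<in> F - {v}" for u
      using that Suc.prems(1) Suc.prems(2)[of u] rem[of u]
      by (auto simp: topple_def split: if_splits)
    show "?x u + deg_in E (F - {v}) u = c u" if u: "u \<in> V - {s} - (F - {v})" for u
    proof (cases "u = v")
      case True
      then show ?thesis using Suc.prems(2)[OF v(1)] rem[of v] no_loop[of v] unstable
        by (simp add: topple_def)
    next
      case False
      then show ?thesis using u Suc.prems(3)[of u] rem[of u]
        by (auto simp: topple_def split: if_splits)
    qed
    show "?x u = c u" if "u \<notin> V - {s}" for u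
      using that Suc.prems(4)[of u] vV edge_in_V[of u v] by (auto simp: topple_def)
  qed
  moreover have "topple_step V E s x ?x" using vV unstable unfolding topple_step_def by blast
  ultimately show ?case by (simp add: converse_rtranclp_into_rtranclp)
qed

lemma topple_step_add:
  "topple_step V E s x y \<Longrightarrow> topple_step V E s (\<lambda>v. x v + z v) (\<lambda>v. y v + z v)"
proof -
  assume "topple_step V E s x y"
  then obtain v where v: "v \<in> V - {s}" "degree E v \<le> x v" "y = topple E s v x"
    unfolding topple_step_def by blast
  then have "(\<lambda>u. y u + z u) = topple E s v (\<lambda>u. x u + z u)"
    by (auto simp: topple_def)
  then show ?thesis using v unfolding topple_step_def by (intro bexI[of _ v]) auto
qed

lemma topple_steps_add:
  "(topple_step V E s)\<^sup>*\<^sup>* x y \<Longrightarrow> (topple_step V E s)\<^sup>*\<^sup>* (\<lambda>v. x v + z v) (\<lambda>v. y v + z v)"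
proof (induction rule: rtranclp_induct)
  case (step y w)
  from step.IH topple_step_add[OF step.hyps(2), of z] show ?case
    by (rule rtranclp.rtrancl_into_rtrancl[of "topple_step V E s"])
qed simp

text \<open>A toppling of the sink adds one grain at every other vertex, so the burning algorithm undoes
  \<open>k\<close> such topplings one at a time.\<close>

lemma sink_topplings_return:
  assumes "no_forbidden (V - {s}) E c"
  shows "(topple_step V E s)\<^sup>*\<^sup>* (\<lambda>v. c v + (if v \<in> V - {s} then k else 0)) c"
proof (induction k)
  case (Suc k)
  let ?b = "\<lambda>k v. if v \<in> V - {s} then k else (0::nat)"
  have "(topple_step V E s)\<^sup>*\<^sup>* (\<lambda>v. c v + ?b 1 v) c"
    by (rule burning[OF assms subset_refl]) (auto simp: degree_nonsink)
  from topple_steps_add[OF this, of "?b k"]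
  have "(topple_step V E s)\<^sup>*\<^sup>* (\<lambda>v. c v + ?b (Suc k) v) (\<lambda>v. c v + ?b k v)"
    by (rule back_subst[where P = "\<lambda>x. (topple_step V E s)\<^sup>*\<^sup>* x (\<lambda>v. c v + ?b k v)"]) auto
  then show ?case using Suc.IH by (rule rtranclp_trans)
qed simp

theorem recurrent_iff_no_forbidden:
  "recurrent V E s c \<longleftrightarrow>
     c \<in> configs V s \<and> stable V E s c \<and> no_forbidden (V - {s}) E c"
proof
  assume "recurrent V E s c"
  then show "c \<in> configs V s \<and> stable V E s c \<and> no_forbidden (V - {s}) E c"
    using recurrent_imp_no_forbidden by (auto simp: recurrent_def)
next
  assume c: "c \<in> configs V s \<and> stable V E s c \<and> no_forbidden (V - {s}) E c"
  have "\<exists>e \<in> configs V s. stabilisation V E s (\<lambda>v. d v + e v) c" if d: "d \<in> configs V s" for d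
  proof -
    define k where "k = sum d (V - {s})"
    have dk: "d v \<le> k" if "v \<in> V - {s}" for v
      unfolding k_def using that finite_V by (intro member_le_sum) auto
    \<comment> \<open>The grains that complete \<open>d\<close> to \<open>c\<close> after \<open>k\<close> topplings of the sink; by the
      choice of \<open>k\<close> the subtraction is not truncated.\<close>
    let ?e = "\<lambda>v. if v \<in> V - {s} then c v + k - d v else 0"
    have "(\<lambda>v. d v + ?e v) = (\<lambda>v. c v + (if v \<in> V - {s} then k else 0))"
      using c d dk by (force simp: configs_def fun_eq_iff intro: trans_le_add2)
    then have "stabilisation V E s (\<lambda>v. d v + ?e v) c"
      using sink_topplings_return[of c k] c by (simp only: stabilisation_def)
    moreover have "?e \<in> configs V s" by (simp add: configs_def)
    ultimately show ?thesis by (rule bexI[of _ ?e])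
  qed
  with c show "recurrent V E s c" by (simp add: recurrent_def)
qed

end

section \<open>Forbidden sets in complete split graphs\<close>

lemma split_edge_iff [simp]:
  "{Clique i, Clique j} \<in> split_edges m n \<longleftrightarrow> i \<in> {1..m} \<and> j \<in> {1..m} \<and> i \<noteq> j"
  "{Clique i, Indep k} \<in> split_edges m n \<longleftrightarrow> i \<in> {1..m} \<and> k \<in> {1..n}"
  "{Indep k, Clique i} \<in> split_edges m n \<longleftrightarrow> i \<in> {1..m} \<and> k \<in> {1..n}"
  "{Indep k, Indep l} \<notin> split_edges m n"
  unfolding split_edges_def by (auto simp: doubleton_eq_iff)

lemma split_universal_sink:
  assumes "m \<ge> 1"
  shows "universal_sink (split_verts m n) (split_edges m n) (Clique m)"
proof
  show "finite (split_verts m n)" by (simp add: split_verts_def)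
  show "Clique m \<in> split_verts m n" using assms by (simp add: split_verts_def)
  show "\<exists>u v. e = {u, v} \<and> u \<in> split_verts m n \<and> v \<in> split_verts m n \<and> u \<noteq> v"
    if "e \<in> split_edges m n" for e
  proof -
    from that consider
        i j where "e = {Clique i, Clique j}" "i \<in> {1..m}" "j \<in> {1..m}" "i \<noteq> j"
      | i j where "e = {Clique i, Indep j}" "i \<in> {1..m}" "j \<in> {1..n}"
      unfolding split_edges_def by blast
    then show ?thesis
    proof cases
      case 1
      then show ?thesis
        by (intro exI[of _ "Clique i"] exI[of _ "Clique j"]) (simp add: split_verts_def)
    next
      case 2
      then show ?thesis
        by (intro exI[of _ "Clique i"] exI[of _ "Indep j"]) (simp add: split_verts_def)
    qed
  qed
  show "{Clique m, v} \<in> split_edges m n" if "v \<in> split_verts m n - {Clique m}" for v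
    using that assms unfolding split_verts_def by auto
qed

lemma nonsink_split: "split_verts m n - {Clique m} = Clique ` {1..m - 1} \<union> Indep ` {1..n}"
proof (rule set_eqI)
  fix v
  show "v \<in> split_verts m n - {Clique m} \<longleftrightarrow> v \<in> Clique ` {1..m - 1} \<union> Indep ` {1..n}"
    by (cases v) (auto simp: split_verts_def)
qed

lemma deg_in_split:
  assumes "A \<subseteq> {1..m}" "B \<subseteq> {1..n}"
  shows "i \<in> A \<Longrightarrow> deg_in (split_edges m n) (Clique ` A \<union> Indep ` B) (Clique i) = card A - 1 + card B"
    and "j \<in> B \<Longrightarrow> deg_in (split_edges m n) (Clique ` A \<union> Indep ` B) (Indep j) = card A"
proof -
  have fin: "finite A" "finite B" using assms finite_subset by blast+
  have range: "\<And>x. x \<in> A \<Longrightarrow> Suc 0 \<le> x \<and> x \<le> m" "\<And>x. x \<in> B \<Longrightarrow> Suc 0 \<le> x \<and> x \<le> n"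
    using assms by auto
  show "deg_in (split_edges m n) (Clique ` A \<union> Indep ` B) (Clique i) = card A - 1 + card B"
    if "i \<in> A"
  proof -
    have "{u \<in> Clique ` A \<union> Indep ` B. {u, Clique i} \<in> split_edges m n}
        = Clique ` (A - {i}) \<union> Indep ` B"
      using range that by auto
    moreover have "Clique ` (A - {i}) \<inter> Indep ` B = {}" by auto
    ultimately show ?thesis
      using fin that by (simp add: deg_in_def card_Un_disjoint card_image inj_on_def)
  qed
  show "deg_in (split_edges m n) (Clique ` A \<union> Indep ` B) (Indep j) = card A" if "j \<in> B"
  proof -
    have "{u \<in> Clique ` A \<union> Indep ` B. {u, Indep j} \<in> split_edges m n} = Clique ` A"
      using range that by auto
    then show ?thesis by (simp add: deg_in_def card_image inj_on_def)
  qed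
qed

lemma degree_split:
  assumes "m \<ge> 1"
  shows "i \<in> {1..m} \<Longrightarrow> degree (split_edges m n) (Clique i) = m - 1 + n"
    and "j \<in> {1..n} \<Longrightarrow> degree (split_edges m n) (Indep j) = m"
  unfolding universal_sink.degree_eq_deg_in[OF split_universal_sink[OF assms]] split_verts_def
  using deg_in_split[of "{1..m}" m "{1..n}" n] by simp_all

text \<open>Monotonicity turns a bound at some clique vertex \<open>v\<^sub>k\<close> with \<open>k \<ge> i\<close> into one at
  \<open>v\<^sub>i\<close>. Conversely, if no independent vertex of \<open>F\<close> shows that \<open>F\<close> is not forbidden, then
  the clique vertex of smallest index in \<open>F\<close> does.\<close>

lemma no_forbidden_split_iff:
  assumes anti: "antimono_on {1..m - 1} (\<lambda>i. c (Clique i))"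
  shows "no_forbidden (split_verts m n - {Clique m}) (split_edges m n) c \<longleftrightarrow>
    (\<forall>i \<in> {1..m - 1}. m - 1 - i + card {j \<in> {1..n}. c (Indep j) < m - i} \<le> c (Clique i))"
    (is "?L \<longleftrightarrow> ?R")
proof
  assume L: ?L
  show ?R
  proof
    fix i assume i: "i \<in> {1..m - 1}"
    let ?A = "{i..m - 1}" and ?B = "{j \<in> {1..n}. c (Indep j) < m - i}"
    have "?A = {i..<m}" using i by auto
    then have card: "card ?A = m - i" by simp
    have sub: "?A \<subseteq> {1..m}" "?B \<subseteq> {1..n}" using i by auto
    note deg = deg_in_split[OF sub, unfolded card]
    have F: "Clique ` ?A \<union> Indep ` ?B \<subseteq> split_verts m n - {Clique m}"
      unfolding nonsink_split using i by auto
    have "Clique ` ?A \<union> Indep ` ?B \<noteq> {}" using i by auto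
    from L[unfolded no_forbidden_def, rule_format, OF F this]
    obtain v where v: "v \<in> Clique ` ?A \<union> Indep ` ?B"
      "deg_in (split_edges m n) (Clique ` ?A \<union> Indep ` ?B) v \<le> c v"
      by blast
    \<comment> \<open>The independent vertices of this set were chosen to have fewer grains than neighbours
      in it.\<close>
    have "v \<noteq> Indep j" if "j \<in> ?B" for j
      using v(2) deg(2)[OF that] that by auto
    then obtain k where k: "v = Clique k" "k \<in> ?A"
      using v(1) by blast
    have "c (Clique k) \<le> c (Clique i)" using anti i k unfolding monotone_on_def by auto
    then show "m - 1 - i + card ?B \<le> c (Clique i)"
      using v(2) deg(1)[OF k(2)] k(1) by simp
  qed
next
  assume R: ?R
  show ?L
    unfolding no_forbidden_def
  proof (intro allI impI)
    fix F assume F: "F \<subseteq> split_verts m n - {Clique m}" "F \<noteq> {}"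
    define A B where "A = {i. Clique i \<in> F}" and "B = {j. Indep j \<in> F}"
    have F_eq: "F = Clique ` A \<union> Indep ` B"
    proof (rule set_eqI)
      fix x
      show "x \<in> F \<longleftrightarrow> x \<in> Clique ` A \<union> Indep ` B"
        by (cases x) (auto simp: A_def B_def)
    qed
    have A: "A \<subseteq> {1..m - 1}" and B: "B \<subseteq> {1..n}"
      using F(1) unfolding nonsink_split A_def B_def by auto
    have sub: "A \<subseteq> {1..m}" using A by (rule order_trans) auto
    note deg = deg_in_split[OF sub B, folded F_eq]
    show "\<exists>v \<in> F. deg_in (split_edges m n) F v \<le> c v"
    proof (cases "\<exists>j \<in> B. card A \<le> c (Indep j)")
      case True
      then obtain j where "j \<in> B" "card A \<le> c (Indep j)" by blast
      then show ?thesis using deg(2)[of j] by (intro bexI[of _ "Indep j"]) (simp_all add: B_def)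
    next
      case False
      then have lt: "c (Indep j) < card A" if "j \<in> B" for j using that by force
      have "A \<noteq> {}" using lt F(2) F_eq by fastforce
      moreover have finA: "finite A" using A finite_subset by blast
      ultimately have i: "Min A \<in> A" by simp
      define i where "i = Min A"
      have iA: "i \<in> A" "i \<in> {1..m - 1}" using i A i_def by auto
      have "A \<subseteq> {i..m - 1}" using A finA i_def by auto
      also have "{i..m - 1} = {i..<m}" using iA by auto
      finally have "card A \<le> card {i..<m}" by (rule card_mono[rotated]) simp
      then have cA: "card A \<le> m - i" by simp
      have "B \<subseteq> {j \<in> {1..n}. c (Indep j) < m - i}" using B lt cA by fastforce
      from card_mono[OF _ this] have "card B \<le> card {j \<in> {1..n}. c (Indep j) < m - i}" by simp
      moreover have "m - 1 - i + card {j \<in> {1..n}. c (Indep j) < m - i} \<le> c (Clique i)"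
        using R iA by blast
      ultimately have "deg_in (split_edges m n) F (Clique i) \<le> c (Clique i)"
        using deg(1)[OF iA(1)] cA by linarith
      then show ?thesis using iA(1) by (intro bexI[of _ "Clique i"]) (simp_all add: A_def)
    qed
  qed
qed

section \<open>Counting Motzkin prefixes\<close>

text \<open>The lists are weakly decreasing, so the head of each belongs to the last letter \<open>D\<close> or
  \<open>H\<close> of the word, and the recursion over the word peels off heads. In \<open>x # xs\<close> the head
  \<open>x\<close> is the position of the \<open>D\<close> numbered \<open>length xs + 1\<close>; the sum is the position of the
  \<open>U\<close> with the same number.\<close>

fun dominates :: "nat list \<Rightarrow> nat list \<Rightarrow> bool" where
  "dominates [] ys \<longleftrightarrow> True"
| "dominates (x # xs) ys \<longleftrightarrow>
     length xs + length (filter (\<lambda>y. y \<le> length xs) ys) \<le> x \<and> dominates xs ys"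

text \<open>The words with \<open>u\<close> letters \<open>U\<close>, \<open>h\<close> letters \<open>H\<close> and \<open>d\<close> letters \<open>D\<close>, such
  that every prefix has at most as many \<open>D\<close> as \<open>U\<close>. The entries of the first list are
  0-based positions among the \<open>u + h\<close> letters different from \<open>D\<close>.\<close>

definition motzkin_pairs :: "nat \<Rightarrow> nat \<Rightarrow> nat \<Rightarrow> (nat list \<times> nat list) set" where
  "motzkin_pairs u h d = {(xs, ys). length xs = d \<and> length ys = h \<and>
     sorted_wrt (\<ge>) xs \<and> sorted_wrt (\<ge>) ys \<and>
     (\<forall>x \<in> set xs. x < u + h) \<and> (\<forall>y \<in> set ys. y \<le> u) \<and> dominates xs ys}"

lemma dominates_iff_nth:
  "dominates xs ys \<longleftrightarrow> (\<forall>i < length xs.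
     length xs - Suc i + length (filter (\<lambda>y. y \<le> length xs - Suc i) ys) \<le> xs ! i)"
  by (induction xs) (auto simp: All_less_Suc2)

lemma dominates_Cons_right:
  "length xs \<le> y \<Longrightarrow> dominates xs (y # ys) \<longleftrightarrow> dominates xs ys"
  by (induction xs) auto

lemma motzkin_pairs_0: "motzkin_pairs 0 0 0 = {([], [])}"
  by (auto simp: motzkin_pairs_def)

text \<open>The three parts are the words that end in \<open>D\<close>, in \<open>H\<close> and in \<open>U\<close>. The last letter is
  \<open>D\<close> iff the first list starts with the largest possible position \<open>u + h - 1\<close>; if not, it is
  \<open>H\<close> iff the second list starts with the largest possible value \<open>u\<close>. A word with
  \<open>d = u\<close> cannot end in \<open>U\<close>.\<close>

lemma motzkin_pairs_rec:
  assumes "d \<le> u" "u + h > 0"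
  shows "motzkin_pairs u h d =
    (if d = 0 then {} else (\<lambda>(xs, ys). ((u + h - 1) # xs, ys)) ` motzkin_pairs u h (d - 1)) \<union>
    ((if h = 0 then {} else (\<lambda>(xs, ys). (xs, u # ys)) ` motzkin_pairs u (h - 1) d) \<union>
     (if d < u then motzkin_pairs (u - 1) h d else {}))"
    (is "?P = ?D \<union> (?H \<union> ?U)")
proof (intro equalityI subsetI)
  fix p assume "p \<in> ?P"
  then obtain xs ys where p: "p = (xs, ys)" and len: "length xs = d" "length ys = h"
    and sorted: "sorted_wrt (\<ge>) xs" "sorted_wrt (\<ge>) ys"
    and xs: "\<forall>x \<in> set xs. x < u + h" and ys: "\<forall>y \<in> set ys. y \<le> u" and dom: "dominates xs ys"
    by (auto simp: motzkin_pairs_def)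
  consider (D) xs' where "xs = (u + h - 1) # xs'" | (noD) "\<forall>x \<in> set xs. x < u + h - 1"
  proof (cases xs)
    case (Cons x xs')
    then show ?thesis using that sorted(1) xs by (cases "x = u + h - 1") fastforce+
  qed (use that in auto)
  then show "p \<in> ?D \<union> (?H \<union> ?U)"
  proof cases
    case D
    then have "(xs', ys) \<in> motzkin_pairs u h (d - 1)" "d \<noteq> 0"
      using len sorted xs ys dom by (auto simp: motzkin_pairs_def)
    then show ?thesis using D p by force
  next
    case noD
    consider (H) ys' where "ys = u # ys'" | (noH) "\<forall>y \<in> set ys. y < u"
    proof (cases ys)
      case (Cons y ys')
      then show ?thesis using that sorted(2) ys by (cases "y = u") fastforce+
    qed (use that in auto)
    then show ?thesis
    proof cases
      case H
      then have "(xs, ys') \<in> motzkin_pairs u (h - 1) d" "h \<noteq> 0"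
        using len sorted xs ys dom noD assms
        by (auto simp: motzkin_pairs_def dominates_Cons_right)
      then show ?thesis using H p by force
    next
      case noH
      have "d < u"
      proof (rule ccontr)
        assume "\<not> d < u"
        then have du: "d = u" using assms by simp
        have "u > 0" using noH assms len by (cases ys) auto
        then obtain x xs' where x: "xs = x # xs'" using du len by (cases xs) auto
        have "filter (\<lambda>y. y \<le> length xs') ys = ys"
          using noH x len du by (auto simp: filter_id_conv)
        then have "u - 1 + h \<le> x" using dom x len du by auto
        then show False using noD x \<open>u > 0\<close> by auto
      qed
      moreover have "(xs, ys) \<in> motzkin_pairs (u - 1) h d"
        using len sorted noD noH dom calculation by (fastforce simp: motzkin_pairs_def)
      ultimately show ?thesis using p by simp
    qed
  qed
next
  fix p assume "p \<in> ?D \<union> (?H \<union> ?U)"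
  then consider (D) "p \<in> ?D" | (H) "p \<in> ?H" | (U) "p \<in> ?U" by blast
  then show "p \<in> ?P"
  proof cases
    case D
    then obtain xs ys where p: "p = ((u + h - 1) # xs, ys)" "d > 0"
      and q: "(xs, ys) \<in> motzkin_pairs u h (d - 1)"
      by (auto split: if_splits)
    have "length (filter (\<lambda>y. y \<le> length xs) ys) \<le> h"
      using q by (auto simp: motzkin_pairs_def)
    moreover have "length xs = d - 1" using q by (simp add: motzkin_pairs_def)
    ultimately have "length xs + length (filter (\<lambda>y. y \<le> length xs) ys) \<le> u + h - 1"
      using assms p(2) by linarith
    then show ?thesis using p q assms by (auto simp: motzkin_pairs_def)
  next
    case H
    then obtain xs ys where "p = (xs, u # ys)" "h > 0" "(xs, ys) \<in> motzkin_pairs u (h - 1) d"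
      by (auto split: if_splits)
    then show ?thesis using assms
      by (fastforce simp: motzkin_pairs_def dominates_Cons_right)
  next
    case U
    then show ?thesis by (fastforce simp: motzkin_pairs_def split: if_splits)
  qed
qed

lemma card_motzkin_pairs_rec:
  assumes "d \<le> u" "u + h > 0"
    and "d > 0 \<Longrightarrow> finite (motzkin_pairs u h (d - 1))"
    and "h > 0 \<Longrightarrow> finite (motzkin_pairs u (h - 1) d)"
    and "d < u \<Longrightarrow> finite (motzkin_pairs (u - 1) h d)"
  shows "finite (motzkin_pairs u h d)"
    and "card (motzkin_pairs u h d) =
      (if d = 0 then 0 else card (motzkin_pairs u h (d - 1))) +
      (if h = 0 then 0 else card (motzkin_pairs u (h - 1) d)) +
      (if d < u then card (motzkin_pairs (u - 1) h d) else 0)"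
proof -
  let ?D = "if d = 0 then {} else (\<lambda>(xs, ys). ((u + h - 1) # xs, ys)) ` motzkin_pairs u h (d - 1)"
  let ?H = "if h = 0 then {} else (\<lambda>(xs, ys). (xs, u # ys)) ` motzkin_pairs u (h - 1) d"
  let ?U = "if d < u then motzkin_pairs (u - 1) h d else {}"
  note rec = motzkin_pairs_rec[OF assms(1,2)]
  have fin: "finite ?D" "finite ?H" "finite ?U" using assms by auto
  show "finite (motzkin_pairs u h d)" unfolding rec using fin by blast
  have "u \<in> set (snd p)" if "p \<in> ?H" for p
    using that by (auto split: if_splits)
  moreover have "u \<notin> set (snd p)" if "p \<in> ?U" for p
    using that by (fastforce simp: motzkin_pairs_def split: if_splits)
  ultimately have "?H \<inter> ?U = {}" by blast
  moreover have "u + h - 1 \<in> set (fst p)" if "p \<in> ?D" for p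
    using that by (auto split: if_splits)
  moreover have "u + h - 1 \<notin> set (fst p)" if "p \<in> ?H \<union> ?U" for p
    using that by (fastforce simp: motzkin_pairs_def split: if_splits)
  ultimately have "?H \<inter> ?U = {}" "?D \<inter> (?H \<union> ?U) = {}" by blast+
  then have "card (motzkin_pairs u h d) = card ?D + (card ?H + card ?U)"
    unfolding rec using fin card_Un_disjoint[of ?D "?H \<union> ?U"] card_Un_disjoint[of ?H ?U]
    by (metis finite_UnI)
  moreover have "card ?D = (if d = 0 then 0 else card (motzkin_pairs u h (d - 1)))"
    by (auto intro!: card_image inj_onI)
  moreover have "card ?H = (if h = 0 then 0 else card (motzkin_pairs u (h - 1) d))"
    by (auto intro!: card_image inj_onI)
  ultimately show "card (motzkin_pairs u h d) =
      (if d = 0 then 0 else card (motzkin_pairs u h (d - 1))) +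
      (if h = 0 then 0 else card (motzkin_pairs u (h - 1) d)) +
      (if d < u then card (motzkin_pairs (u - 1) h d) else 0)"
    by simp
qed

text \<open>The solution is the multinomial coefficient of \<open>u\<close>, \<open>d\<close>, \<open>h\<close> times the ballot factor
  \<open>(u + 1 - d) / (u + 1)\<close>. This factor vanishes at \<open>d = u + 1\<close>, so the missing words
  that end in \<open>U\<close> cause no exception in the recursion.\<close>

lemma card_motzkin_pairs:
  assumes "d \<le> u"
  shows "finite (motzkin_pairs u h d) \<and>
    real (card (motzkin_pairs u h d)) =
      fact (u + d + h) * (real u + 1 - real d) / (fact (Suc u) * fact d * fact h)"
  using assms
proof (induction "u + d + h" arbitrary: u d h)
  case 0
  then show ?case by (simp add: motzkin_pairs_0)
next
  case (Suc N)
  \<comment> \<open>Each of the three smaller counts is a polynomial multiple of this common factor.\<close>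
  define W :: real where "W = fact N / (fact (Suc u) * fact d * fact h)"
  have pos: "u + h > 0" using Suc(2) Suc.prems by linarith
  have D: "finite (motzkin_pairs u h (d - 1))"
    "real (card (motzkin_pairs u h (d - 1))) = W * d * (real u + 2 - real d)" if "d > 0"
  proof -
    obtain e where e: "d = Suc e" using \<open>d > 0\<close> by (cases d) auto
    have W: "fact N / (fact (Suc u) * fact e * fact h) = W * real d"
      by (simp add: W_def e divide_simps del: of_nat_Suc)
    have "N = u + e + h" using Suc(2) e by simp
    note IH = Suc(1)[OF this]
    show "finite (motzkin_pairs u h (d - 1))" using IH Suc.prems e by simp
    have "real (card (motzkin_pairs u h (d - 1))) = fact N / (fact (Suc u) * fact e * fact h) * (real u + 1 - real e)"
      using IH Suc.prems e \<open>N = u + e + h\<close> by simp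
    then show "real (card (motzkin_pairs u h (d - 1))) = W * d * (real u + 2 - real d)"
      unfolding W using e by simp
  qed
  have H: "finite (motzkin_pairs u (h - 1) d)"
    "real (card (motzkin_pairs u (h - 1) d)) = W * h * (real u + 1 - real d)" if "h > 0"
  proof -
    obtain e where e: "h = Suc e" using \<open>h > 0\<close> by (cases h) auto
    have W: "fact N / (fact (Suc u) * fact d * fact e) = W * real h"
      by (simp add: W_def e divide_simps del: of_nat_Suc)
    have "N = u + d + e" using Suc(2) e by simp
    note IH = Suc(1)[OF this]
    show "finite (motzkin_pairs u (h - 1) d)" using IH Suc.prems e by simp
    have "real (card (motzkin_pairs u (h - 1) d)) = fact N / (fact (Suc u) * fact d * fact e) * (real u + 1 - real d)"
      using IH Suc.prems e \<open>N = u + d + e\<close> by simp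
    then show "real (card (motzkin_pairs u (h - 1) d)) = W * h * (real u + 1 - real d)"
      unfolding W using e by simp
  qed
  have U: "finite (motzkin_pairs (u - 1) h d)"
    "real (card (motzkin_pairs (u - 1) h d)) = W * (real u + 1) * (real u - real d)" if "d < u"
  proof -
    obtain e where e: "u = Suc e" using \<open>d < u\<close> by (cases u) auto
    have W: "fact N / (fact u * fact d * fact h) = W * (real u + 1)"
      by (simp add: W_def divide_simps)
    have N: "N = e + d + h" using Suc(2) e by simp
    note IH = Suc(1)[OF N]
    show "finite (motzkin_pairs (u - 1) h d)" using IH that e by simp
    have "real (card (motzkin_pairs (u - 1) h d)) = fact N / (fact u * fact d * fact h) * (real u - real d)"
      using IH e that N by simp
    then show "real (card (motzkin_pairs (u - 1) h d)) = W * (real u + 1) * (real u - real d)"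
      unfolding W using e by simp
  qed
  have fin: "finite (motzkin_pairs u h d)"
    by (rule card_motzkin_pairs_rec(1)[OF Suc.prems pos]) (erule D(1) H(1) U(1))+
  have rec: "card (motzkin_pairs u h d) =
      (if d = 0 then 0 else card (motzkin_pairs u h (d - 1))) +
      (if h = 0 then 0 else card (motzkin_pairs u (h - 1) d)) +
      (if d < u then card (motzkin_pairs (u - 1) h d) else 0)"
    by (rule card_motzkin_pairs_rec(2)[OF Suc.prems pos]) (erule D(1) H(1) U(1))+
  have "real (card (motzkin_pairs u h d)) =
      W * d * (real u + 2 - real d) + W * h * (real u + 1 - real d)
      + W * (real u + 1) * (real u - real d)"
    unfolding rec using D(2) H(2) U(2) Suc.prems by auto
  also have "\<dots> = W * real (u + d + h) * (real u + 1 - real d)"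
    by (simp add: algebra_simps)
  also have "\<dots> = fact (u + d + h) * (real u + 1 - real d) / (fact (Suc u) * fact d * fact h)"
    unfolding W_def by (simp add: Suc(2)[symmetric])
  finally show ?case using fin by blast
qed

lemma card_motzkin_pairs_balanced:
  assumes "m \<ge> 1"
  shows "real (card (motzkin_pairs (m - 1) n (m - 1))) =
    1 / real m * real ((2 * m - 2) choose (m - 1)) * real ((2 * m - 2 + n) choose n)"
proof -
  obtain k where k: "m = Suc k" using assms by (cases m) auto
  have "real (card (motzkin_pairs k n k)) = fact (2 * k + n) / (fact (Suc k) * fact k * fact n)"
    using card_motzkin_pairs[of k k n] by (simp add: mult_2)
  also have "\<dots> = 1 / real (Suc k) * (fact (2 * k) / (fact k * fact k)) *
      (fact (2 * k + n) / (fact n * fact (2 * k)))"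
    by simp
  also have "\<dots> = 1 / real (Suc k) * real ((2 * k) choose k) * real ((2 * k + n) choose n)"
    by (simp add: binomial_fact mult_2)
  finally show ?thesis by (simp add: k)
qed

section \<open>Weakly decreasing recurrent configurations\<close>

definition config_lists :: "nat \<Rightarrow> nat \<Rightarrow> (split_vertex \<Rightarrow> nat) \<Rightarrow> nat list \<times> nat list" where
  "config_lists m n c =
     (map (\<lambda>i. c (Clique i)) [1..<m], map (\<lambda>j. c (Indep j)) [1..<Suc n])"

lemma antimono_on_iff_sorted_wrt:
  fixes f :: "nat \<Rightarrow> nat"
  shows "antimono_on {1..k} f \<longleftrightarrow> sorted_wrt (\<ge>) (map f [1..<Suc k])"
proof
  assume "antimono_on {1..k} f"
  then show "sorted_wrt (\<ge>) (map f [1..<Suc k])"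
    by (auto simp: sorted_wrt_iff_nth_less monotone_on_def simp del: upt_Suc)
next
  assume s: "sorted_wrt (\<ge>) (map f [1..<Suc k])"
  have "f j \<le> f i" if ij: "i \<in> {1..k}" "j \<in> {1..k}" "i < j" for i j
    using sorted_wrt_nth_less[OF s, of "i - 1" "j - 1"] ij by (simp del: upt_Suc) 
  then show "antimono_on {1..k} f"
    by (auto simp: monotone_on_def le_less)
qed

lemma length_filter_upt:
  "length (filter P (map f [1..<Suc n])) = card {j \<in> {1..n}. P (f j)}"
proof -
  have "length (filter P (map f [1..<Suc n])) = card (set (filter (P \<circ> f) [1..<Suc n]))"
    by (subst distinct_card) (simp_all add: filter_map)
  also have "set (filter (P \<circ> f) [1..<Suc n]) = {j \<in> {1..n}. P (f j)}"
    by (auto simp del: upt_Suc)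
  finally show ?thesis .
qed

text \<open>Stability gives the upper bounds on the entries of the lists, and Dhar's criterion gives
  \<^const>\<open>dominates\<close>: the list index \<open>i\<close> belongs to the clique vertex with index \<open>i + 1\<close>.\<close>

lemma recurrent_split_iff:
  assumes m: "m \<ge> 1"
  shows "recurrent (split_verts m n) (split_edges m n) (Clique m) c \<and> weakly_decreasing m n c
    \<longleftrightarrow> c \<in> configs (split_verts m n) (Clique m) \<and>
        config_lists m n c \<in> motzkin_pairs (m - 1) n (m - 1)"
proof -
  interpret universal_sink "split_verts m n" "split_edges m n" "Clique m"
    by (rule split_universal_sink[OF m])
  let ?xs = "map (\<lambda>i. c (Clique i)) [1..<m]" and ?ys = "map (\<lambda>j. c (Indep j)) [1..<Suc n]"
  have upt: "[1..<m] = [1..<Suc (m - 1)]" using m by simp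
  have wd: "weakly_decreasing m n c \<longleftrightarrow> sorted_wrt (\<ge>) ?xs \<and> sorted_wrt (\<ge>) ?ys"
    unfolding weakly_decreasing_def antimono_on_iff_sorted_wrt upt ..
  have st: "stable (split_verts m n) (split_edges m n) (Clique m) c \<longleftrightarrow>
      (\<forall>x \<in> set ?xs. x < m - 1 + n) \<and> (\<forall>y \<in> set ?ys. y \<le> m - 1)"
  proof -
    have "degree (split_edges m n) (Clique i) = m - 1 + n" if "i \<in> {1..m - 1}" for i
      using that by (intro degree_split[OF m]) auto
    then have "stable (split_verts m n) (split_edges m n) (Clique m) c \<longleftrightarrow>
      (\<forall>i \<in> {1..m - 1}. c (Clique i) < m - 1 + n) \<and> (\<forall>j \<in> {1..n}. c (Indep j) < m)"
      unfolding stable_def nonsink_split by (simp add: ball_Un degree_split[OF m])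
    moreover have "y < m \<longleftrightarrow> y \<le> m - 1" for y using m by auto
    moreover have "set [1..<m] = {1..m - 1}" "set [1..<Suc n] = {1..n}" using m by auto
    ultimately show ?thesis by (simp only: set_map ball_simps)
  qed
  have dom: "dominates ?xs ?ys \<longleftrightarrow>
     (\<forall>i \<in> {1..m - 1}. m - 1 - i + card {j \<in> {1..n}. c (Indep j) < m - i} \<le> c (Clique i))"
  proof -
    have "dominates ?xs ?ys \<longleftrightarrow> (\<forall>i < m - 1.
       m - 1 - Suc i + card {j \<in> {1..n}. c (Indep j) \<le> m - 1 - Suc i} \<le> c (Clique (Suc i)))"
      unfolding dominates_iff_nth length_filter_upt by simp
    also have "\<dots> \<longleftrightarrow> (\<forall>i \<in> {1..m - 1}.
       m - 1 - i + card {j \<in> {1..n}. c (Indep j) \<le> m - 1 - i} \<le> c (Clique i))"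
      unfolding image_Suc_lessThan[symmetric] by auto
    also have "\<dots> \<longleftrightarrow> (\<forall>i \<in> {1..m - 1}. m - 1 - i + card {j \<in> {1..n}. c (Indep j) < m - i} \<le> c (Clique i))"
    proof (rule ball_cong[OF refl])
      fix i assume "i \<in> {1..m - 1}"
      then have "x \<le> m - 1 - i \<longleftrightarrow> x < m - i" for x by auto
      then show "(m - 1 - i + card {j \<in> {1..n}. c (Indep j) \<le> m - 1 - i} \<le> c (Clique i)) =
        (m - 1 - i + card {j \<in> {1..n}. c (Indep j) < m - i} \<le> c (Clique i))" by simp
    qed
    finally show ?thesis .
  qed
  have "config_lists m n c \<in> motzkin_pairs (m - 1) n (m - 1) \<longleftrightarrow>
     stable (split_verts m n) (split_edges m n) (Clique m) c \<and> weakly_decreasing m n c \<and>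
     dominates ?xs ?ys"
    unfolding config_lists_def motzkin_pairs_def st wd by (auto simp del: upt_Suc)
  moreover have "weakly_decreasing m n c \<Longrightarrow>
      no_forbidden (split_verts m n - {Clique m}) (split_edges m n) c \<longleftrightarrow> dominates ?xs ?ys"
    unfolding dom by (rule no_forbidden_split_iff) (simp only: weakly_decreasing_def)
  ultimately show ?thesis
    unfolding recurrent_iff_no_forbidden by argo
qed

lemma bij_betw_config_lists:
  "bij_betw (config_lists m n) (configs (split_verts m n) (Clique m))
     {(xs, ys). length xs = m - 1 \<and> length ys = n}"
  unfolding bij_betw_def
proof (intro conjI subset_antisym subsetI inj_onI ext)
  fix c c' v assume c: "c \<in> configs (split_verts m n) (Clique m)"
    and c': "c' \<in> configs (split_verts m n) (Clique m)"
    and eq: "config_lists m n c = config_lists m n c'"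
  \<comment> \<open>The lists determine a configuration because it vanishes off the non-sink vertices.\<close>
  show "c v = c' v"
  proof (cases "v \<in> split_verts m n - {Clique m}")
    case True
    have "\<forall>i \<in> set [1..<m]. c (Clique i) = c' (Clique i)"
      "\<forall>j \<in> set [1..<Suc n]. c (Indep j) = c' (Indep j)"
      using eq unfolding config_lists_def prod.inject map_eq_conv by simp_all
    moreover have "set [1..<m] = {1..m - 1}" "set [1..<Suc n] = {1..n}" by auto
    ultimately have "\<forall>i \<in> {1..m - 1}. c (Clique i) = c' (Clique i)"
      "\<forall>j \<in> {1..n}. c (Indep j) = c' (Indep j)" by (simp_all only:)
    then show ?thesis using True unfolding nonsink_split by blast
  next
    case False
    have "f v = 0" if "f \<in> configs (split_verts m n) (Clique m)" for f
      using that[unfolded configs_def, THEN CollectD, THEN spec, THEN mp, OF False] .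
    with c c' have "c v = 0" "c' v = 0" by (simp_all only:)
    then show ?thesis by simp
  qed
next
  fix p assume "p \<in> config_lists m n ` configs (split_verts m n) (Clique m)"
  then show "p \<in> {(xs, ys). length xs = m - 1 \<and> length ys = n}"
    by (auto simp: config_lists_def)
next
  fix p :: "nat list \<times> nat list" assume "p \<in> {(xs, ys). length xs = m - 1 \<and> length ys = n}"
  then obtain xs ys where p: "p = (xs, ys)" "length xs = m - 1" "length ys = n" by blast
  define c where "c v = (case v of
      Clique i \<Rightarrow> if i \<in> {1..m - 1} then xs ! (i - 1) else 0
    | Indep j \<Rightarrow> if j \<in> {1..n} then ys ! (j - 1) else 0)" for v
  have "c v = 0" if "v \<notin> Clique ` {1..m - 1} \<union> Indep ` {1..n}" for v
    using that by (cases v) (auto simp: c_def)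
  then have "c \<in> configs (split_verts m n) (Clique m)"
    unfolding configs_def nonsink_split by blast
  moreover have "map (\<lambda>i. c (Clique i)) [1..<m] = xs"
    by (rule nth_equalityI) (simp_all add: c_def p)
  moreover have "map (\<lambda>j. c (Indep j)) [1..<Suc n] = ys"
    by (rule nth_equalityI) (simp_all add: c_def p del: upt_Suc)
  ultimately show "p \<in> config_lists m n ` configs (split_verts m n) (Clique m)"
    unfolding p(1) config_lists_def by (intro image_eqI[of _ _ c]) simp_all
qed

theorem corollary3p4:
  fixes m n :: nat
  assumes "m \<ge> 1" and "n \<ge> 1"
  shows "real (card {c. recurrent (split_verts m n) (split_edges m n) (Clique m) c \<and>
                        weakly_decreasing m n c})
         = 1 / real m * real ((2 * m - 2) choose (m - 1)) * real ((2 * m - 2 + n) choose n)"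
proof -
  let ?C = "configs (split_verts m n) (Clique m)" and ?P = "motzkin_pairs (m - 1) n (m - 1)"
  note bij = bij_betw_config_lists[of m n]
  have sub: "?P \<subseteq> config_lists m n ` ?C"
    unfolding bij_betw_imp_surj_on[OF bij] by (auto simp: motzkin_pairs_def)
  have image: "config_lists m n ` {c \<in> ?C. config_lists m n c \<in> ?P} = ?P"
  proof (intro subset_antisym subsetI)
    fix p assume p: "p \<in> ?P"
    with sub obtain c where "c \<in> ?C" "p = config_lists m n c" by blast
    with p show "p \<in> config_lists m n ` {c \<in> ?C. config_lists m n c \<in> ?P}" by simp
  qed blast
  have "inj_on (config_lists m n) {c \<in> ?C. config_lists m n c \<in> ?P}"
    using bij_betw_imp_inj_on[OF bij] Collect_restrict by (rule inj_on_subset)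
  from card_image[OF this] have "card {c \<in> ?C. config_lists m n c \<in> ?P} = card ?P"
    unfolding image by (rule sym)
  then show ?thesis
    by (simp only: recurrent_split_iff[OF assms(1)] card_motzkin_pairs_balanced[OF assms(1)])
qed

end
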